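(* Let $N\ge 1$, $\tau>0$, let $f:[0,+\infty)\times[0,+\infty)^{2N}\to\mathbb{R}^N$ be continuous, and consider the delay system $x'(t)=f(t,x(t),x(t-\tau))$. Let $V:(0,+\infty)^N\to(0,+\infty)$ be $C^1$ with $\lim_{|x|\to0}V(x)=0$. Assume: (i) if $x,y\in[0,+\infty)^N$ satisfy $x_j=0$ for some $j\in\{1,\dots,N\}$ and $y\neq0$, then $f_j(t,x,y)>0$ for all $t>0$; (ii) there exist $t_0,r_0>0$ such that $\langle\nabla V(x),f(t,x,x)\rangle>0$ for all $t>t_0$ and all $x\in(0,+\infty)^N$ with $V(x)<r_0$; (iii) $\langle\nabla V(x),f(t,x,y)\rangle\ge\langle\nabla V(x),f(t,x,x)\rangle$ for all $t\ge 0$ and all $x,y\in(0,+\infty)^N$ with $V(y)\ge V(x)$. Then the system is strongly persistent.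
   Context: An initial condition is $x_0=\varphi$ with $\varphi:[-\tau,0]\to[0,+\infty)^N$ continuous, where $x_t(s)=x(t+s)$ for $s\in[-\tau,0]$. It is a standing assumption that the system induces a semi-flow $\Phi(t,\varphi)=x_t$ on $C([-\tau,0],[0,+\infty)^N)$: for each such $\varphi$ the solution exists, is unique, is defined for all $t\ge0$ and stays in $[0,+\infty)^N$. Condition (i) is imposed in order that solutions with initial data $\varphi\not\equiv0$ be strictly positive; it is part of the setting that for each such solution $x(t)\in(0,+\infty)^N$ for all sufficiently large $t$, so that $V(x(t))$ is defined there. The system is strongly persistent if $\liminf_{t\to+\infty}|x(t)|>0$ for every solution with continuous initial condition $\varphi:[-\tau,0]\to[0,+\infty)^N$, $\varphi\not\equiv0$. Here $|\cdot|$ is the Euclidean norm and $\langle\cdot,\cdot\rangle$ the Euclidean inner product. *)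

theory Defs
  imports "HOL-Analysis.Analysis"
begin

definition nonneg_orthant :: "(real ^ 'n) set" where
  "nonneg_orthant = {x. \<forall>i. 0 \<le> x $ i}"

definition pos_orthant :: "(real ^ 'n) set" where
  "pos_orthant = {x. \<forall>i. 0 < x $ i}"

definition gradient :: "('a::real_inner \<Rightarrow> real) \<Rightarrow> 'a \<Rightarrow> 'a" where
  "gradient V x = (THE D. GDERIV V x :> D)"

text \<open>Intended for open \<open>S\<close>: the derivative is the two-sided one at every point of \<open>S\<close>.\<close>

definition C1_on :: "'a::real_inner set \<Rightarrow> ('a \<Rightarrow> real) \<Rightarrow> bool" where
  "C1_on S V \<longleftrightarrow> (\<forall>x\<in>S. \<exists>D. GDERIV V x :> D) \<and> continuous_on S (gradient V)"

definition initial_conditions :: "real \<Rightarrow> (real \<Rightarrow> real ^ 'n) set" where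
  "initial_conditions \<tau> =
    {\<phi>. continuous_on {-\<tau>..0} \<phi> \<and> (\<forall>s\<in>{-\<tau>..0}. \<phi> s \<in> nonneg_orthant)}"

definition nonzero_initial_conditions :: "real \<Rightarrow> (real \<Rightarrow> real ^ 'n) set" where
  "nonzero_initial_conditions \<tau> =
    {\<phi> \<in> initial_conditions \<tau>. \<exists>s\<in>{-\<tau>..0}. \<phi> s \<noteq> 0}"

text \<open>
  \<open>delay_solution f \<tau> b \<phi> x\<close>: the function \<open>x\<close> solves \<open>x'(t) = f(t, x(t), x(t - \<tau>))\<close>
  on \<open>[0, b)\<close> with initial condition \<open>\<phi>\<close>; \<open>b = \<infinity>\<close> is allowed, and the derivative
  at \<open>0\<close> is the right-hand one. Values of \<open>x\<close> outside \<open>[-\<tau>, b)\<close> are irrelevant.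
  The right-hand side is meaningful on the nonnegative orthant only, although \<open>f\<close> is
  a total function here, so the values of a solution are required to lie there.
\<close>

definition delay_solution ::
  "(real \<Rightarrow> real ^ 'n \<Rightarrow> real ^ 'n \<Rightarrow> real ^ 'n) \<Rightarrow> real \<Rightarrow> ereal \<Rightarrow>
    (real \<Rightarrow> real ^ 'n) \<Rightarrow> (real \<Rightarrow> real ^ 'n) \<Rightarrow> bool" where
  "delay_solution f \<tau> b \<phi> x \<longleftrightarrow>
    (\<forall>s\<in>{-\<tau>..0}. x s = \<phi> s) \<and>
    continuous_on {t. -\<tau> \<le> t \<and> ereal t < b} x \<and>
    (\<forall>t. 0 \<le> t \<and> ereal t < b \<longrightarrow> x t \<in> nonneg_orthant) \<and>
    (\<forall>t. 0 \<le> t \<and> ereal t < b \<longrightarrow>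
      (x has_vector_derivative f t (x t) (x (t - \<tau>))) (at t within {0..}))"

text \<open>
  Every nonnegative initial condition has a solution on \<open>[0, \<infinity>)\<close>, and every solution
  with the same initial condition, even if only defined up to some \<open>b\<close>, is a
  restriction of it.
\<close>

definition induces_semiflow ::
  "(real \<Rightarrow> real ^ 'n \<Rightarrow> real ^ 'n \<Rightarrow> real ^ 'n) \<Rightarrow> real \<Rightarrow> bool" where
  "induces_semiflow f \<tau> \<longleftrightarrow>
    (\<forall>\<phi> \<in> initial_conditions \<tau>. \<exists>x. delay_solution f \<tau> \<infinity> \<phi> x \<and>
      (\<forall>b y. 0 < b \<and> delay_solution f \<tau> b \<phi> y \<longrightarrow>
        (\<forall>t. 0 \<le> t \<and> ereal t < b \<longrightarrow> y t = x t)))"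

definition eventually_positive ::
  "(real \<Rightarrow> real ^ 'n \<Rightarrow> real ^ 'n \<Rightarrow> real ^ 'n) \<Rightarrow> real \<Rightarrow> bool" where
  "eventually_positive f \<tau> \<longleftrightarrow>
    (\<forall>\<phi> \<in> nonzero_initial_conditions \<tau>. \<forall>x. delay_solution f \<tau> \<infinity> \<phi> x \<longrightarrow>
      (\<forall>\<^sub>F t in at_top. x t \<in> pos_orthant))"

definition strongly_persistent ::
  "(real \<Rightarrow> real ^ 'n \<Rightarrow> real ^ 'n \<Rightarrow> real ^ 'n) \<Rightarrow> real \<Rightarrow> bool" where
  "strongly_persistent f \<tau> \<longleftrightarrow>
    (\<forall>\<phi> \<in> nonzero_initial_conditions \<tau>. \<forall>x. delay_solution f \<tau> \<infinity> \<phi> x \<longrightarrow>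
      Liminf at_top (\<lambda>t. ereal (norm (x t))) > 0)"

end

theory Submission
  imports Defs
begin

text \<open>
  Consider a solution \<open>x\<close> from a time on at which it is positive and (ii) is in force.
  The scalar function \<open>v t = V (x t)\<close> cannot fall below the smaller of \<open>r0\<close> and its
  minimum over the first delay interval of length \<open>\<tau>\<close>. Suppose that it did, and let
  \<open>s\<close> minimise \<open>v\<close> up to such a time. Then \<open>s\<close> lies beyond the first delay interval, and
  \<open>v (s - \<tau>) \<ge> v s\<close> merely because \<open>s\<close> is a minimiser. So (iii) compares the delayed
  vector field with the undelayed one and (ii) gives \<open>v' s > 0\<close>. Hence \<open>v\<close> is smaller
  just before \<open>s\<close>, which contradicts minimality (\<open>delay_lower_barrier\<close>).

  So \<open>V (x t)\<close> stays above a positive constant, and since \<open>V y\<close> tends to \<open>0\<close> as \<open>y\<close>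
  tends to \<open>0\<close>, the norm of \<open>x t\<close> stays above a positive constant too.
\<close>

text \<open>
  The derivative is only asked to be positive where the current value does not exceed the
  delayed one, which is all that (iii) can supply. The bound \<open>m\<close> on one full delay
  interval pushes a minimiser \<open>s\<close> with a lower value beyond \<open>a + \<tau>\<close>, so that \<open>s - \<tau>\<close>
  still lies in the range over which \<open>s\<close> is minimal.
\<close>

lemma delay_lower_barrier:
  fixes v v' :: "real \<Rightarrow> real"
  assumes tau: "\<tau> > 0"
    and cont: "continuous_on {a..} v"
    and deriv: "\<And>t. t > a + \<tau> \<Longrightarrow> (v has_real_derivative v' t) (at t)"
    and increasing: "\<And>t. t > a + \<tau> \<Longrightarrow> v t < m \<Longrightarrow> v t \<le> v (t - \<tau>) \<Longrightarrow> v' t > 0"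
    and initial: "\<And>t. t \<in> {a..a + \<tau>} \<Longrightarrow> m \<le> v t"
    and "t \<ge> a"
  shows "m \<le> v t"
proof (rule ccontr)
  assume "\<not> m \<le> v t"
  have "continuous_on {a..t} v"
    using cont by (rule continuous_on_subset) auto
  then obtain s where s: "s \<in> {a..t}" and s_min: "\<And>u. u \<in> {a..t} \<Longrightarrow> v s \<le> v u"
    using continuous_attains_inf[of "{a..t}" v] \<open>t \<ge> a\<close> by auto
  have "v s < m"
    using s_min[of t] \<open>t \<ge> a\<close> \<open>\<not> m \<le> v t\<close> by auto
  then have late: "s > a + \<tau>"
    using initial[of s] s by force
  have "v s \<le> v (s - \<tau>)"
    using s_min[of "s - \<tau>"] s late tau by auto
  then have "v' s > 0"
    using increasing late \<open>v s < m\<close> by blast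
  then obtain d where d: "d > 0" and drop: "\<And>h. h > 0 \<Longrightarrow> h < d \<Longrightarrow> v (s - h) < v s"
    using DERIV_pos_inc_left[OF deriv[OF late]] by blast
  define h where "h = min (d / 2) \<tau>"
  have "v (s - h) < v s"
    using drop[of h] d tau by (auto simp: h_def)
  moreover have "s - h \<in> {a..t}"
    using s late tau d by (auto simp: h_def)
  ultimately show False
    using s_min[of "s - h"] by simp
qed

lemma GDERIV_gradient:
  assumes "C1_on S V" and "x \<in> S"
  shows "GDERIV V x :> gradient V x"
proof -
  obtain D where D: "GDERIV V x :> D"
    using assms unfolding C1_on_def by blast
  have "E = D" if "GDERIV V x :> E" for E
  proof -
    have "(\<lambda>h. h \<bullet> E) = (\<lambda>h. h \<bullet> D)"
      using that D unfolding gderiv_def by (rule has_derivative_unique)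
    then have "h \<bullet> E = h \<bullet> D" for h
      by (rule fun_cong)
    then show ?thesis
      using vector_eq_ldot[of E D] by blast
  qed
  then have "gradient V x = D"
    unfolding gradient_def using D by (intro the_equality)
  with D show ?thesis
    by simp
qed

lemma GDERIV_along_curve:
  fixes x :: "real \<Rightarrow> 'a::real_inner"
  assumes V: "GDERIV V (x t) :> D"
    and x: "(x has_vector_derivative x') (at t)"
  shows "((\<lambda>s. V (x s)) has_real_derivative D \<bullet> x') (at t)"
proof -
  have "((\<lambda>s. V (x s)) has_derivative (\<lambda>h. (h *\<^sub>R x') \<bullet> D)) (at t)"
    using has_derivative_compose[OF x[unfolded has_vector_derivative_def]
        V[unfolded gderiv_def]] by simp
  then show ?thesis
    unfolding has_field_derivative_def
    by (rule has_derivative_eq_rhs) (auto simp: inner_commute)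
qed

lemma norm_bounded_below_if_V_bounded_below:
  fixes V :: "real ^ 'n \<Rightarrow> real"
  assumes lim: "(V \<longlongrightarrow> 0) (at 0 within pos_orthant)" and "c > 0"
  obtains \<delta> where "\<delta> > 0" and "\<And>y. y \<in> pos_orthant \<Longrightarrow> c \<le> V y \<Longrightarrow> \<delta> \<le> norm y"
proof -
  have "\<forall>\<^sub>F y in at 0 within pos_orthant. V y < c"
    using lim \<open>c > 0\<close> by (rule order_tendstoD(2))
  then obtain \<delta> where "\<delta> > 0"
    and small: "\<And>y. y \<in> pos_orthant \<Longrightarrow> y \<noteq> 0 \<Longrightarrow> norm y < \<delta> \<Longrightarrow> V y < c"
    unfolding eventually_at by auto
  have "\<delta> \<le> norm y" if "y \<in> pos_orthant" and "c \<le> V y" for y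
    using small[of y] that by (force simp: pos_orthant_def)
  with \<open>\<delta> > 0\<close> that show thesis
    by blast
qed

theorem proposition2:
  fixes f :: "real \<Rightarrow> real ^ 'n \<Rightarrow> real ^ 'n \<Rightarrow> real ^ 'n"
    and V :: "real ^ 'n \<Rightarrow> real"
    and \<tau> :: real
  assumes tau: "\<tau> > 0"
    and f_cont: "continuous_on ({0..} \<times> nonneg_orthant \<times> nonneg_orthant) (\<lambda>(t, x, y). f t x y)"
    and semiflow: "induces_semiflow f \<tau>"
    and positive: "eventually_positive f \<tau>"
    and V_pos: "\<forall>x\<in>pos_orthant. V x > 0"
    and V_C1: "C1_on pos_orthant V"
    and V_lim: "(V \<longlongrightarrow> 0) (at 0 within pos_orthant)"
    and i: "\<forall>x\<in>nonneg_orthant. \<forall>y\<in>nonneg_orthant. \<forall>j.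
              x $ j = 0 \<and> y \<noteq> 0 \<longrightarrow> (\<forall>t>0. f t x y $ j > 0)"
    and ii: "\<exists>t0>0. \<exists>r0>0. \<forall>t>t0. \<forall>x\<in>pos_orthant.
              V x < r0 \<longrightarrow> gradient V x \<bullet> f t x x > 0"
    and iii: "\<forall>t\<ge>0. \<forall>x\<in>pos_orthant. \<forall>y\<in>pos_orthant.
              V y \<ge> V x \<longrightarrow> gradient V x \<bullet> f t x y \<ge> gradient V x \<bullet> f t x x"
  shows "strongly_persistent f \<tau>"
  unfolding strongly_persistent_def
proof (intro ballI allI impI)
  fix \<phi> x
  assume phi: "\<phi> \<in> nonzero_initial_conditions \<tau>" and sol: "delay_solution f \<tau> \<infinity> \<phi> x"
  obtain t0 r0 where "t0 > 0" "r0 > 0"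
    and inward: "\<And>t y. t > t0 \<Longrightarrow> y \<in> pos_orthant \<Longrightarrow> V y < r0 \<Longrightarrow> gradient V y \<bullet> f t y y > 0"
    using ii by blast
  obtain T where T: "\<And>t. t \<ge> T \<Longrightarrow> x t \<in> pos_orthant"
    using positive phi sol unfolding eventually_positive_def eventually_at_top_linorder by blast
  define a where "a = max T t0"
  have x_pos: "x t \<in> pos_orthant" if "t \<ge> a" for t
    using T that by (auto simp: a_def)
  have "a > 0"
    using \<open>t0 > 0\<close> by (auto simp: a_def)
  define v where "v = (\<lambda>t. V (x t))"
  define v' where "v' = (\<lambda>t. gradient V (x t) \<bullet> f t (x t) (x (t - \<tau>)))"
  have v_deriv: "(v has_real_derivative v' t) (at t)" if "t \<ge> a" for t
  proof -
    have "(x has_vector_derivative f t (x t) (x (t - \<tau>))) (at t within {0..})"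
      using sol that \<open>a > 0\<close> unfolding delay_solution_def by auto
    moreover have "at t within {0..} = at t"
      using that \<open>a > 0\<close> by (intro at_within_interior) auto
    ultimately show ?thesis
      unfolding v_def v'_def
      using GDERIV_along_curve GDERIV_gradient[OF V_C1 x_pos[OF that]] by metis
  qed
  have v_cont: "continuous_on {a..} v"
    by (rule DERIV_continuous_on, rule has_field_derivative_at_within, rule v_deriv) simp
  obtain u where "u \<in> {a..a + \<tau>}" and u_min: "\<And>t. t \<in> {a..a + \<tau>} \<Longrightarrow> v u \<le> v t"
    using continuous_attains_inf[of "{a..a + \<tau>}" v] continuous_on_subset[OF v_cont] tau by auto
  define m where "m = min r0 (v u)"
  have "m > 0"
    using \<open>r0 > 0\<close> V_pos x_pos \<open>u \<in> {a..a + \<tau>}\<close> by (auto simp: m_def v_def)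
  have v_lower: "m \<le> v t" if "t \<ge> a" for t
  proof (rule delay_lower_barrier[OF tau v_cont _ _ _ that])
    show "(v has_real_derivative v' t) (at t)" if "t > a + \<tau>" for t
      using v_deriv that tau by simp
    show "v' t > 0" if "t > a + \<tau>" and "v t < m" and "v t \<le> v (t - \<tau>)" for t
    proof -
      have pos: "x t \<in> pos_orthant" "x (t - \<tau>) \<in> pos_orthant"
        using that(1) tau by (auto intro: x_pos)
      have "t > t0"
        using that(1) tau by (simp add: a_def)
      then have "0 < gradient V (x t) \<bullet> f t (x t) (x t)"
        using inward[of t "x t"] that(2) pos \<open>t > t0\<close> by (auto simp: v_def m_def)
      also have "\<dots> \<le> v' t"
        unfolding v'_def using iii pos that(3) \<open>t > t0\<close> \<open>t0 > 0\<close> by (auto simp: v_def)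
      finally show ?thesis .
    qed
    show "m \<le> v t" if "t \<in> {a..a + \<tau>}" for t
      using u_min[OF that] by (auto simp: m_def)
  qed
  obtain \<delta> where "\<delta> > 0"
    and away: "\<And>y. y \<in> pos_orthant \<Longrightarrow> m \<le> V y \<Longrightarrow> \<delta> \<le> norm y"
    using norm_bounded_below_if_V_bounded_below[OF V_lim \<open>m > 0\<close>] by blast
  have "\<forall>\<^sub>F t in at_top. ereal \<delta> \<le> ereal (norm (x t))"
    using eventually_ge_at_top[of a]
    by (rule eventually_mono) (use away x_pos v_lower in \<open>simp add: v_def\<close>)
  then have "ereal \<delta> \<le> Liminf at_top (\<lambda>t. ereal (norm (x t)))"
    by (rule Liminf_bounded)
  with \<open>\<delta> > 0\<close> show "Liminf at_top (\<lambda>t. ereal (norm (x t))) > 0"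
    by (metis ereal_less(2) less_le_trans)
qed

end
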